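(* Let $\boldsymbol u_1,\boldsymbol u_2\in\mathbb R^d$ with $|\boldsymbol u_1|,|\boldsymbol u_2|<c$, let $W=w(\boldsymbol u_2)\,w(\boldsymbol u_1)$, $Q_{\mathrm{end}}=W^{-1}Q_*W^{-\mathrm T}$ and $q_{00}=(Q_{\mathrm{end}})_{00}$. Put $\gamma_i=(1-|\boldsymbol u_i|^2/c^2)^{-1/2}$ and $$\boldsymbol w=\Bigl(1-\frac{\boldsymbol u_1\cdot\boldsymbol u_2}{c^2}\Bigr)\boldsymbol u_2+\frac{\boldsymbol u_1}{\gamma_2}+\Bigl(1-\frac1{\gamma_2}\Bigr)(\hat{\boldsymbol u}_2\cdot\boldsymbol u_1)\hat{\boldsymbol u}_2 .$$ Then $$q_{00}=\gamma_1^2\gamma_2^2\Bigl(1-\frac{|\boldsymbol w|^2}{c^2}\Bigr)=\frac{(c^2-\boldsymbol u_1\cdot\boldsymbol u_2)^2-c^2|\boldsymbol u_1|^2}{c^2\,(c^2-|\boldsymbol u_1|^2)},$$ and, when $q_{00}>0$, the frequency dilation $\rho:=q_{00}^{-1/2}$ is $$\rho=\frac{\gamma(\boldsymbol w)}{\gamma_1\gamma_2},\qquad \gamma(\boldsymbol w)=(1-|\boldsymbol w|^2/c^2)^{-1/2}.$$ In particular $q_{00}$ and $\rho$ depend only on $|\boldsymbol u_1|$ and $\boldsymbol u_1\cdot\boldsymbol u_2$ (not on $|\boldsymbol u_2|$ separately), and $\rho=1+\boldsymbol u_1\cdot\boldsymbol u_2/c^2+O(M^4)$ as $M:=\max(|\boldsymbol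 u_1|,|\boldsymbol u_2|)/c\to0$.
   Context: Fix $c>0$ and $d\in\{2,3\}$; coordinates on $\mathbb R^{1+d}$ are $(t,\boldsymbol x)$ and the index $0$ refers to $t$. For $|\boldsymbol v|<c$ let $\gamma=(1-|\boldsymbol v|^2/c^2)^{-1/2}$, $\hat{\boldsymbol v}=\boldsymbol v/|\boldsymbol v|$ (terms containing $\hat{\boldsymbol v}$ are read as $0$ if $\boldsymbol v=0$), and define the linear maps (identified with matrices) $g(\boldsymbol v):(t,\boldsymbol x)\mapsto(t,\boldsymbol x-\boldsymbol vt)$, $\ell(\boldsymbol v):(t,\boldsymbol x)\mapsto\bigl(\gamma(t-\boldsymbol v\cdot\boldsymbol x/c^2),\ \boldsymbol x+(\gamma-1)(\hat{\boldsymbol v}\cdot\boldsymbol x)\hat{\boldsymbol v}-\gamma\boldsymbol vt\bigr)$, and $w(\boldsymbol v)=\ell(-\boldsymbol v)\,g(\boldsymbol v)$. Also $Q_*=\begin{pmatrix}1&0\\0&-c^2I\end{pmatrix}$. *)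

theory Defs
  imports "HOL-Analysis.Analysis" "HOL-Library.Landau_Symbols"
begin

text \<open>Vectors of \<open>\<real>^(1+d)\<close> are indexed by the type \<open>'n option\<close> with \<open>CARD('n) = d\<close>: the index
  \<^const>\<open>None\<close> is the time index \<open>0\<close>, the indices \<open>Some i\<close> are the spatial ones.\<close>

definition event :: "real \<Rightarrow> real ^ 'n \<Rightarrow> real ^ 'n option" where
  "event t x = (\<chi> a. case a of None \<Rightarrow> t | Some i \<Rightarrow> x $ i)"

definition time_part :: "real ^ ('n::finite) option \<Rightarrow> real" where
  "time_part z = z $ None"

definition space_part :: "real ^ 'n option \<Rightarrow> real ^ 'n" where
  "space_part z = (\<chi> i. z $ Some i)"

definition lorentz_factor :: "real \<Rightarrow> real ^ 'n \<Rightarrow> real" where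
  "lorentz_factor c v = 1 / sqrt (1 - (norm v)\<^sup>2 / c\<^sup>2)"

definition galilei :: "real ^ 'n \<Rightarrow> real ^ 'n option \<Rightarrow> real ^ 'n option" where
  "galilei v z = event (time_part z) (space_part z - time_part z *\<^sub>R v)"

text \<open>The unit vector in the direction of \<open>v\<close> is \<^term>\<open>sgn v\<close>, which is \<open>0\<close> for \<open>v = 0\<close>.\<close>

definition boost :: "real \<Rightarrow> real ^ 'n \<Rightarrow> real ^ 'n option \<Rightarrow> real ^ 'n option" where
  "boost c v z =
    event (lorentz_factor c v * (time_part z - v \<bullet> space_part z / c\<^sup>2))
      (space_part z + ((lorentz_factor c v - 1) * (sgn v \<bullet> space_part z)) *\<^sub>R sgn v
         - (lorentz_factor c v * time_part z) *\<^sub>R v)"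

definition w_map :: "real \<Rightarrow> real ^ 'n \<Rightarrow> real ^ 'n option \<Rightarrow> real ^ 'n option" where
  "w_map c v = boost c (- v) \<circ> galilei v"

definition Q_star :: "real \<Rightarrow> real ^ ('n::finite) option ^ 'n option" where
  "Q_star c = (\<chi> a b. if a \<noteq> b then 0 else if a = None then 1 else - c\<^sup>2)"

definition W_mat :: "real \<Rightarrow> real ^ 'n \<Rightarrow> real ^ 'n \<Rightarrow> real ^ 'n option ^ 'n option" where
  "W_mat c u1 u2 = matrix (w_map c u2) ** matrix (w_map c u1)"

definition Q_end :: "real \<Rightarrow> real ^ 'n \<Rightarrow> real ^ 'n \<Rightarrow> real ^ 'n option ^ 'n option" where
  "Q_end c u1 u2 =
    matrix_inv (W_mat c u1 u2) ** Q_star c ** transpose (matrix_inv (W_mat c u1 u2))"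

definition q00 :: "real \<Rightarrow> real ^ 'n \<Rightarrow> real ^ 'n \<Rightarrow> real" where
  "q00 c u1 u2 = Q_end c u1 u2 $ None $ None"

definition frequency_dilation :: "real \<Rightarrow> real ^ 'n \<Rightarrow> real ^ 'n \<Rightarrow> real" where
  "frequency_dilation c u1 u2 = 1 / sqrt (q00 c u1 u2)"

definition w_vec :: "real \<Rightarrow> real ^ 'n \<Rightarrow> real ^ 'n \<Rightarrow> real ^ 'n" where
  "w_vec c u1 u2 =
    (1 - u1 \<bullet> u2 / c\<^sup>2) *\<^sub>R u2 + (1 / lorentz_factor c u2) *\<^sub>R u1
      + ((1 - 1 / lorentz_factor c u2) * (sgn u2 \<bullet> u1)) *\<^sub>R sgn u2"

definition mach :: "real \<Rightarrow> real ^ 'n \<Rightarrow> real ^ 'n \<Rightarrow> real" where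
  "mach c u1 u2 = max (norm u1) (norm u2) / c"

text \<open>\<^const>\<open>matrix\<close> and \<^const>\<open>matrix_inv\<close> have the intended meaning only for linear maps and
  invertible matrices; the following facts show that this is the case here.\<close>

lemma time_part_event [simp]: "time_part (event t x) = t"
  by (simp add: time_part_def event_def)

lemma space_part_event [simp]: "space_part (event t x) = x"
  by (simp add: space_part_def event_def vec_eq_iff)

lemma event_parts [simp]: "event (time_part z) (space_part z) = z"
  by (auto simp: time_part_def space_part_def event_def vec_eq_iff split: option.split)

lemma event_eq_iff: "z = z' \<longleftrightarrow> time_part z = time_part z' \<and> space_part z = space_part z'"
  by (metis event_parts)

lemma time_part_linear [simp]: "time_part (x + y) = time_part x + time_part y" "time_part (r *\<^sub>R x) = r * time_part x"
  by (simp_all add: time_part_def)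

lemma space_part_linear [simp]: "space_part (x + y) = space_part x + space_part y" "space_part (r *\<^sub>R x) = r *\<^sub>R space_part x"
  by (simp_all add: space_part_def vec_eq_iff)

lemma linear_galilei: "linear (galilei v)"
  by (rule linearI) (simp_all add: event_eq_iff galilei_def algebra_simps)

lemma linear_boost: "linear (boost c v)"
  by (rule linearI)
    (simp_all add: event_eq_iff boost_def algebra_simps add_divide_distrib)

lemma linear_w_map: "linear (w_map c v)"
  unfolding w_map_def by (intro linear_compose linear_galilei linear_boost)

lemma galilei_galilei_uminus: "galilei (- v) (galilei v z) = z"
  by (simp add: event_eq_iff galilei_def)

lemma boost_boost_uminus:
  assumes "c > 0" "norm v < c"
  shows "boost c v (boost c (- v) z) = z"
proof (cases "v = 0")
  case True
  then show ?thesis by (simp add: event_eq_iff boost_def lorentz_factor_def)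
next
  case False
  define n where "n = norm v"
  define e where "e = sgn v"
  define G where "G = lorentz_factor c v"
  define t where "t = time_part z"
  define x where "x = space_part z"
  define p where "p = e \<bullet> x"
  have n: "n > 0" "n < c" and v: "v = n *\<^sub>R e" and ee: "e \<bullet> e = 1"
    using False assms by (simp_all add: n_def e_def sgn_div_norm dot_square_norm power2_eq_square)
  have "n\<^sup>2 < c\<^sup>2" using n by (intro power_strict_mono) auto
  then have pos: "1 - n\<^sup>2 / c\<^sup>2 > 0" using assms by simp
  then have "G\<^sup>2 * (1 - n\<^sup>2 / c\<^sup>2) = 1"
    unfolding G_def lorentz_factor_def n_def[symmetric]
    using \<open>n\<^sup>2 < c\<^sup>2\<close> by (simp add: power_divide)
  then have G: "G\<^sup>2 * n\<^sup>2 / c\<^sup>2 = G\<^sup>2 - 1" by (simp add: field_simps)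
  have b1: "boost c (- v) z =
      event (G * (t + n * p / c\<^sup>2)) (x + ((G - 1) * p + G * t * n) *\<^sub>R e)"
    by (simp add: boost_def G_def lorentz_factor_def t_def x_def p_def v[symmetric]
        sgn_minus e_def[symmetric] scaleR_add_left)
      (simp add: v add.assoc)
  define T where "T = G * (t + n * p / c\<^sup>2)"
  define q where "q = (G - 1) * p + G * t * n"
  have ex: "e \<bullet> (x + q *\<^sub>R e) = p + q" by (simp add: inner_add_right p_def ee)
  have "boost c v (event T (x + q *\<^sub>R e)) =
      event (G * (T - n * (p + q) / c\<^sup>2)) (x + (q + (G - 1) * (p + q) - G * T * n) *\<^sub>R e)"
    unfolding boost_def time_part_event space_part_event G_def[symmetric] e_def[symmetric] ex
    by (subst (1 2) v) (simp add: p_def[symmetric] ee algebra_simps)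
  moreover have "G * (T - n * (p + q) / c\<^sup>2) = (G\<^sup>2 - G\<^sup>2 * n\<^sup>2 / c\<^sup>2) * t"
    by (simp add: T_def q_def power2_eq_square algebra_simps add_divide_distrib diff_divide_distrib)
  moreover have "q + (G - 1) * (p + q) - G * T * n = (G\<^sup>2 - 1 - G\<^sup>2 * n\<^sup>2 / c\<^sup>2) * p"
    by (simp add: T_def q_def power2_eq_square algebra_simps add_divide_distrib diff_divide_distrib)
  ultimately show ?thesis
    using G by (simp add: b1 T_def[symmetric] q_def[symmetric]) (simp add: t_def x_def)
qed

lemma invertible_w_map:
  assumes "c > 0" "norm v < c"
  shows "invertible (matrix (w_map c v))"
proof -
  have "inj (w_map c v)"
  proof (rule inj_on_inverseI)
    show "galilei (- v) (boost c v (w_map c v z)) = z" for z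
      using assms by (simp add: w_map_def boost_boost_uminus galilei_galilei_uminus)
  qed
  then have "inj ((*v) (matrix (w_map c v)))"
    by (simp add: matrix_works linear_w_map)
  then show ?thesis
    by (simp add: invertible_left_inverse matrix_left_invertible_injective)
qed

lemma invertible_W_mat:
  assumes "c > 0" "norm u1 < c" "norm u2 < c"
  shows "invertible (W_mat c u1 u2)"
  unfolding W_mat_def using assms by (intro invertible_mult invertible_w_map)

end

theory Submission imports Defs begin

text \<open>Only the time row of the inverse matrix enters \<open>q\<^sub>0\<^sub>0\<close>. As \<open>w(v)\<^sup>-\<^sup>1 = g(-v) \<ell>(v)\<close>, that row is
  \<open>\<gamma>\<^sub>1 \<gamma>\<^sub>2 (1, -w/c\<^sup>2)\<close>, which gives the first formula; splitting \<open>u\<^sub>1\<close> into components along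
  and orthogonal to \<open>u\<^sub>2\<close> gives the second. With \<open>x = |u\<^sub>1|\<^sup>2/c\<^sup>2\<close> and \<open>s = u\<^sub>1 \<bullet> u\<^sub>2/c\<^sup>2\<close> the latter reads
  \<open>q\<^sub>0\<^sub>0 = ((1 - s)\<^sup>2 - x)/(1 - x)\<close>, where \<open>x\<close> and \<open>|s|\<close> are at most \<open>M\<^sup>2\<close>, and
  \<open>q\<^sub>0\<^sub>0 (1 + s)\<^sup>2\<close> differs from \<open>1\<close> only by terms of order \<open>M\<^sup>4\<close>.\<close>

section \<open>Quadratic forms of events\<close>

lemma inner_event:
  fixes x :: "real ^ 'n::finite"
  shows "event t x \<bullet> z = t * time_part z + x \<bullet> space_part z"
proof -
  have "event t x \<bullet> z = event t x $ None * z $ None + (\<Sum>i\<in>UNIV. event t x $ Some i * z $ Some i)"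
    by (simp add: inner_vec_def UNIV_option_conv sum.reindex)
  then show ?thesis
    by (simp add: inner_vec_def event_def time_part_def space_part_def)
qed

lemma Q_star_mult: "Q_star c *v event t x = event t ((- c\<^sup>2) *\<^sub>R x)"
  for x :: "real ^ 'n::finite"
proof -
  have "(Q_star c *v event t x) $ a = event t ((- c\<^sup>2) *\<^sub>R x) $ a" for a
  proof -
    have "Q_star c $ a $ b * event t x $ b =
        (if a = b then (if a = None then 1 else - c\<^sup>2) * event t x $ b else 0)" for b
      by (simp add: Q_star_def)
    then have "(Q_star c *v event t x) $ a =
        (\<Sum>b\<in>UNIV. if a = b then (if a = None then 1 else - c\<^sup>2) * event t x $ b else 0)"
      unfolding matrix_vector_mult_def vec_lambda_beta by (simp only:)
    also have "\<dots> = (if a = None then 1 else - c\<^sup>2) * event t x $ a" by simp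
    finally show ?thesis by (simp add: event_def split: option.split)
  qed
  then show ?thesis by (simp add: vec_eq_iff)
qed

text \<open>Reduces \<open>q00\<close> to the value of the form \<open>Q_star c\<close> at a single
  vector, the time row of \<open>matrix_inv (W_mat c u1 u2)\<close>.\<close>

lemma congruence_diagonal_entry: "(A ** B ** transpose A) $ i $ i = A $ i \<bullet> (B *v A $ i)"
  for A B :: "real ^ 'n ^ 'n"
proof -
  have "(A ** B ** transpose A) $ i $ i = (\<Sum>k\<in>UNIV. \<Sum>l\<in>UNIV. A $ i $ l * B $ l $ k * A $ i $ k)"
    by (simp add: matrix_matrix_mult_def transpose_def sum_distrib_right)
  also have "\<dots> = (\<Sum>l\<in>UNIV. \<Sum>k\<in>UNIV. A $ i $ l * B $ l $ k * A $ i $ k)"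
    by (rule sum.swap)
  finally show ?thesis
    by (simp add: inner_vec_def matrix_vector_mult_def sum_distrib_left mult.assoc)
qed

section \<open>Lorentz factors and the inverse of the composed map\<close>

lemma lorentz_factor_uminus [simp]: "lorentz_factor c (- v) = lorentz_factor c v"
  by (simp add: lorentz_factor_def)

lemma one_minus_norm_pos: "0 < 1 - (norm v)\<^sup>2 / c\<^sup>2" if "c > 0" "norm v < c"
proof -
  have "(norm v)\<^sup>2 < c\<^sup>2" using that by (intro power_strict_mono) auto
  then show ?thesis using that by simp
qed

lemma lorentz_factor_pos: "0 < lorentz_factor c v" if "c > 0" "norm v < c"
  using one_minus_norm_pos[OF that] by (simp add: lorentz_factor_def)

lemma lorentz_factor_square: "(lorentz_factor c v)\<^sup>2 = 1 / (1 - (norm v)\<^sup>2 / c\<^sup>2)" if "c > 0" "norm v < c"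
  using one_minus_norm_pos[OF that] by (simp add: lorentz_factor_def power_divide)

definition w_map_inv :: "real \<Rightarrow> real ^ 'n::finite \<Rightarrow> real ^ 'n option \<Rightarrow> real ^ 'n option" where
  "w_map_inv c v = galilei (- v) \<circ> boost c v"

lemma w_map_w_map_inv: "w_map c v (w_map_inv c v z) = z" if "c > 0" "norm v < c"
  \<comment> \<open>The Galilei pair cancels first, then the boost pair; both carry signs opposite
    to those in the cancellation lemmas, hence the instances at \<open>- v\<close>.\<close>
  using boost_boost_uminus[of c "- v" "z"] galilei_galilei_uminus[of "- v"] that
  by (simp add: w_map_def w_map_inv_def)

lemma matrix_inv_left:
  fixes A :: "real ^ 'n ^ 'm"
  assumes "invertible A"
  shows "matrix_inv A ** A = mat 1"
  using someI_ex[OF assms[unfolded invertible_def]] by (simp add: matrix_inv_def)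

text \<open>Since \<open>W_mat c u1 u2\<close> is invertible, it suffices to exhibit a preimage of
  \<open>z\<close>; undoing \<open>w_map c u2\<close> first and \<open>w_map c u1\<close> second
  yields one.\<close>

lemma matrix_inv_W_mat:
  assumes "c > 0" "norm u1 < c" "norm u2 < c"
  shows "matrix_inv (W_mat c u1 u2) *v z = w_map_inv c u1 (w_map_inv c u2 z)"
proof -
  let ?y = "w_map_inv c u1 (w_map_inv c u2 z)"
  have "W_mat c u1 u2 *v ?y = z"
    unfolding W_mat_def matrix_vector_mul_assoc[symmetric]
    using assms by (simp add: matrix_works linear_w_map w_map_w_map_inv)
  then have "matrix_inv (W_mat c u1 u2) *v z = (matrix_inv (W_mat c u1 u2) ** W_mat c u1 u2) *v ?y"
    by (metis matrix_vector_mul_assoc)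
  also have "\<dots> = ?y"
    using matrix_inv_left[OF invertible_W_mat[OF assms]] by simp
  finally show ?thesis .
qed

text \<open>This is where \<open>w_vec\<close> comes from. The last Galilei map keeps time, so only
  the time component of \<open>boost c u1\<close> matters. In the coefficient of
  \<open>time_part z\<close> the two terms in \<open>u1 \<bullet> u2 / c\<^sup>2\<close> cancel; in
  that of \<open>space_part z\<close>, taking out the product of the Lorentz factors and
  \<open>- 1 / c\<^sup>2\<close> leaves \<open>w_vec c u1 u2\<close>.\<close>

lemma time_part_w_map_inv:
  assumes "c > 0" "norm u2 < c"
  shows "time_part (w_map_inv c u1 (w_map_inv c u2 z)) =
    lorentz_factor c u1 * lorentz_factor c u2 * (time_part z - w_vec c u1 u2 \<bullet> space_part z / c\<^sup>2)"
proof -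
  have "lorentz_factor c u2 \<noteq> 0" using lorentz_factor_pos[OF assms] by simp
  then show ?thesis using \<open>c > 0\<close>
    by (simp add: w_map_inv_def galilei_def boost_def w_vec_def inner_add_left inner_add_right
        inner_diff_right inner_commute[of "sgn u2" u1])
      (simp add: field_simps power2_eq_square)
qed

lemma matrix_inv_W_mat_time_row:
  assumes "c > 0" "norm u1 < c" "norm u2 < c"
  defines "\<Gamma> \<equiv> lorentz_factor c u1 * lorentz_factor c u2"
  shows "matrix_inv (W_mat c u1 u2) $ None = event \<Gamma> ((- \<Gamma> / c\<^sup>2) *\<^sub>R w_vec c u1 u2)"
proof -
  \<comment> \<open>The row is identified through its inner products with all \<open>z\<close>,
    which are the time parts of the images of \<open>z\<close>.\<close>
  have "matrix_inv (W_mat c u1 u2) $ None \<bullet> z = event \<Gamma> ((- \<Gamma> / c\<^sup>2) *\<^sub>R w_vec c u1 u2) \<bullet> z" for z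
  proof -
    have "matrix_inv (W_mat c u1 u2) $ None \<bullet> z = time_part (matrix_inv (W_mat c u1 u2) *v z)"
      by (simp add: time_part_def matrix_vector_mul_component)
    then show ?thesis
      using assms
      by (simp add: matrix_inv_W_mat time_part_w_map_inv inner_event algebra_simps)
  qed
  then show ?thesis using vector_eq_rdot by blast
qed

lemma q00_lorentz:
  assumes "c > 0" "norm u1 < c" "norm u2 < c"
  shows "q00 c u1 u2 =
    (lorentz_factor c u1)\<^sup>2 * (lorentz_factor c u2)\<^sup>2 * (1 - (norm (w_vec c u1 u2))\<^sup>2 / c\<^sup>2)"
  \<comment> \<open>On the time row the spatial term is \<open>- c\<^sup>2\<close> times the squared
    norm of \<open>(- \<Gamma> / c\<^sup>2) *\<^sub>R w_vec c u1 u2\<close>, with \<Gamma> the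
    product of the Lorentz factors; one \<open>c\<^sup>2\<close> cancels.\<close>
  using assms
  by (simp add: q00_def Q_end_def congruence_diagonal_entry matrix_inv_W_mat_time_row Q_star_mult
      inner_event dot_square_norm field_simps power2_eq_square)

text \<open>The first factor on the right is the reciprocal of the squared Lorentz factor of
  \<open>u2\<close>, so it cancels in \<open>q00_lorentz\<close>; this is why \<open>norm u2\<close>
  drops out of \<open>q00\<close>.\<close>

lemma one_minus_norm_w_vec:
  assumes "c > 0" "norm u2 < c"
  shows "1 - (norm (w_vec c u1 u2))\<^sup>2 / c\<^sup>2 =
    (1 - (norm u2)\<^sup>2 / c\<^sup>2) * ((1 - u1 \<bullet> u2 / c\<^sup>2)\<^sup>2 - (norm u1)\<^sup>2 / c\<^sup>2)"
proof (cases "u2 = 0")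
  case True
  \<comment> \<open>Here \<open>sgn u2 = 0\<close> and the Lorentz factor is 1, so
    \<open>w_vec c u1 u2\<close> is \<open>u1\<close>.\<close>
  then show ?thesis by (simp add: w_vec_def lorentz_factor_def)
next
  case False
  define n where "n = norm u2"
  define e where "e = sgn u2"
  define p where "p = e \<bullet> u1"
  define h where "h = 1 / lorentz_factor c u2"
  define k where "k = (1 - n * p / c\<^sup>2) * n + (1 - h) * p"
  have u2: "u2 = n *\<^sub>R e" and ee: "e \<bullet> e = 1"
    using False by (simp_all add: n_def e_def sgn_div_norm dot_square_norm power2_eq_square)
  have u12: "u1 \<bullet> u2 = n * p" by (subst u2) (simp add: p_def inner_commute)
  have h: "h\<^sup>2 = 1 - n\<^sup>2 / c\<^sup>2"
    using lorentz_factor_square[OF assms] by (simp add: h_def n_def power_divide)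
  have "w_vec c u1 u2 = (1 - n * p / c\<^sup>2) *\<^sub>R (n *\<^sub>R e) + h *\<^sub>R u1 + ((1 - h) * p) *\<^sub>R e"
    unfolding w_vec_def u12 h_def[symmetric] e_def[symmetric] p_def[symmetric] by (simp flip: u2)
  then have "w_vec c u1 u2 = k *\<^sub>R e + h *\<^sub>R u1"
    by (simp add: k_def algebra_simps)
  then have "(norm (w_vec c u1 u2))\<^sup>2 = k\<^sup>2 + 2 * k * h * p + h\<^sup>2 * (norm u1)\<^sup>2"
    unfolding power2_norm_eq_inner
    by (simp add: inner_add_left inner_add_right ee p_def inner_commute power2_eq_square
        algebra_simps)
  \<comment> \<open>Pythagoras: \<open>k + h * p\<close> is the component along \<open>e\<close>,
    and the part of \<open>u1\<close> orthogonal to \<open>e\<close> is scaled by \<open>h\<close>.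
    Since \<open>(1 - h) * p + h * p = p\<close>, the parallel component is free of
    \<open>h\<close>; only \<open>h\<^sup>2\<close> survives, and no square root remains.\<close>
  also have "\<dots> = (k + h * p)\<^sup>2 + h\<^sup>2 * ((norm u1)\<^sup>2 - p\<^sup>2)"
    by (simp add: power2_eq_square algebra_simps)
  also have "k + h * p = (1 - n * p / c\<^sup>2) * n + p"
    by (simp add: k_def algebra_simps)
  finally have norm_w: "(norm (w_vec c u1 u2))\<^sup>2 =
      ((1 - n * p / c\<^sup>2) * n + p)\<^sup>2 + h\<^sup>2 * ((norm u1)\<^sup>2 - p\<^sup>2)" .
  show ?thesis
    unfolding norm_w h u12 n_def[symmetric] using \<open>c > 0\<close>
    by (simp add: field_simps power2_eq_square)
qed

lemma q00_scaled:
  assumes "c > 0" "norm u1 < c" "norm u2 < c"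
  shows "q00 c u1 u2 =
    ((1 - u1 \<bullet> u2 / c\<^sup>2)\<^sup>2 - (norm u1)\<^sup>2 / c\<^sup>2) / (1 - (norm u1)\<^sup>2 / c\<^sup>2)"
  using one_minus_norm_pos[OF assms(1,3)] assms
  by (simp add: q00_lorentz one_minus_norm_w_vec lorentz_factor_square)

lemma q00_explicit:
  assumes "c > 0" "norm u1 < c" "norm u2 < c"
  shows "q00 c u1 u2 =
    ((c\<^sup>2 - u1 \<bullet> u2)\<^sup>2 - c\<^sup>2 * (norm u1)\<^sup>2) / (c\<^sup>2 * (c\<^sup>2 - (norm u1)\<^sup>2))"
proof -
  have "(c\<^sup>2 - u1 \<bullet> u2)\<^sup>2 - c\<^sup>2 * (norm u1)\<^sup>2 =
      c ^ 4 * ((1 - u1 \<bullet> u2 / c\<^sup>2)\<^sup>2 - (norm u1)\<^sup>2 / c\<^sup>2)"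
    using \<open>c > 0\<close> by (simp add: field_simps power2_eq_square power4_eq_xxxx)
  moreover have "c\<^sup>2 * (c\<^sup>2 - (norm u1)\<^sup>2) = c ^ 4 * (1 - (norm u1)\<^sup>2 / c\<^sup>2)"
    using \<open>c > 0\<close> by (simp add: field_simps power2_eq_square power4_eq_xxxx)
  ultimately show ?thesis using assms by (simp add: q00_scaled)
qed

text \<open>\<open>sqrt\<close> is multiplicative on the reals, so the positive Lorentz factors
  leave the root of \<open>q00_lorentz\<close> and the remaining root is that of
  \<open>w_vec c u1 u2\<close>.\<close>

lemma frequency_dilation_lorentz:
  assumes "c > 0" "norm u1 < c" "norm u2 < c"
  shows "frequency_dilation c u1 u2 =
    lorentz_factor c (w_vec c u1 u2) / (lorentz_factor c u1 * lorentz_factor c u2)"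
  using lorentz_factor_pos[OF assms(1,2)] lorentz_factor_pos[OF assms(1,3)]
  unfolding frequency_dilation_def q00_lorentz[OF assms] lorentz_factor_def[of c "w_vec c u1 u2"]
  by (simp add: real_sqrt_mult)

section \<open>Expansion for small Mach number\<close>

lemma inverse_sqrt_estimate:
  fixes s x m :: real
  assumes "0 \<le> x" "x \<le> m" "\<bar>s\<bar> \<le> m" "m \<le> 1 / 4"
  defines "q \<equiv> ((1 - s)\<^sup>2 - x) / (1 - x)"
  shows "q > 0" and "\<bar>1 / sqrt q - (1 + s)\<bar> \<le> 26 * m\<^sup>2"
proof -
  define d where "d = (1 - s)\<^sup>2 - x"
  \<comment> \<open>From \<open>m \<le> 1 / 4\<close>: \<open>1 - s\<close> is at least 3/4, so
    \<open>d\<close> is at least 9/16 - 1/4 = 5/16.\<close>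
  have "(3 / 4)\<^sup>2 \<le> (1 - s)\<^sup>2" using assms by (intro power_mono) auto
  then have d: "d \<ge> 5 / 16" using assms by (simp add: d_def power2_eq_square)
  then show q: "q > 0" using assms by (simp add: q_def flip: d_def)
  define r where "r = 1 / sqrt q"
  have r: "r > 0" "r\<^sup>2 = 1 / q" using q by (simp_all add: r_def power_divide)
  \<comment> \<open>The conjugate factor \<open>r + (1 + s)\<close> removes the square root and
    \<open>d\<close> clears the denominator of \<open>1 / q\<close>, so the error becomes a
    polynomial in \<open>s\<close> and \<open>x\<close>.\<close>
  have "(r - (1 + s)) * (r + (1 + s)) * d = (r\<^sup>2 - (1 + s)\<^sup>2) * d"
    by (simp add: power2_eq_square algebra_simps)
  also have "\<dots> = (1 - x) - (1 + s)\<^sup>2 * d"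
    using d assms(2,4) unfolding r q_def d_def[symmetric] by (simp add: field_simps)
  \<comment> \<open>The constant and linear terms cancel because
    \<open>(1 + s)\<^sup>2 * (1 - s)\<^sup>2 = (1 - s\<^sup>2)\<^sup>2\<close>.\<close>
  also have "\<dots> = 2 * s\<^sup>2 - s\<^sup>2 * s\<^sup>2 + 2 * (x * s) + x * s\<^sup>2"
    by (simp add: d_def power2_eq_square algebra_simps)
  finally have eq: "(r - (1 + s)) * (r + (1 + s)) * d = 2 * s\<^sup>2 - s\<^sup>2 * s\<^sup>2 + 2 * (x * s) + x * s\<^sup>2" .
  have s2: "s\<^sup>2 \<le> m\<^sup>2" using assms by (metis abs_ge_zero power2_abs power_mono)
  have xs: "\<bar>x * s\<bar> \<le> m\<^sup>2"
    unfolding abs_mult power2_eq_square using assms by (intro mult_mono) auto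
  have "s\<^sup>2 \<le> 1"
    using assms by (intro abs_square_le_1[THEN iffD2]) auto
  then have ss: "0 \<le> s\<^sup>2 * s\<^sup>2" "s\<^sup>2 * s\<^sup>2 \<le> s\<^sup>2"
    by (simp_all only: zero_le_mult_iff zero_le_power2 mult_left_le simp_thms)
  have xss: "0 \<le> x * s\<^sup>2" "x * s\<^sup>2 \<le> s\<^sup>2"
    using assms by (auto intro: mult_left_le_one_le)
  have "\<bar>r - (1 + s)\<bar> * ((r + (1 + s)) * d) = \<bar>(r - (1 + s)) * (r + (1 + s)) * d\<bar>"
    using r(1) d assms(3,4) by (simp add: abs_mult)
  \<comment> \<open>Each of the four monomials is at most \<open>m\<^sup>2\<close> in absolute
    value, and 2 + 1 + 2 + 1 = 6.\<close>
  also have "\<dots> \<le> 6 * m\<^sup>2"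
    unfolding eq using s2 xs ss xss by linarith
  finally have upper: "\<bar>r - (1 + s)\<bar> * ((r + (1 + s)) * d) \<le> 6 * m\<^sup>2" .
  have "3 / 4 * (5 / 16) \<le> (r + (1 + s)) * d"
    using r(1) d assms(3,4) by (intro mult_mono) auto
  then have "\<bar>r - (1 + s)\<bar> * (3 / 4 * (5 / 16)) \<le> \<bar>r - (1 + s)\<bar> * ((r + (1 + s)) * d)"
    by (intro mult_left_mono) auto
  also note upper
  finally have "\<bar>r - (1 + s)\<bar> * (15 / 64) \<le> 6 * m\<^sup>2" by simp
  \<comment> \<open>The constant is 6 * 64 / 15 = 25.6, rounded up.\<close>
  moreover have "t \<le> 26 * b" if "t * (15 / 64) \<le> 6 * b" "0 \<le> b" for t b :: real
    using that by linarith
  ultimately have "\<bar>r - (1 + s)\<bar> \<le> 26 * m\<^sup>2" by (meson zero_le_power2)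
  then show "\<bar>1 / sqrt q - (1 + s)\<bar> \<le> 26 * m\<^sup>2" by (simp add: r_def)
qed

text \<open>Applies \<open>inverse_sqrt_estimate\<close> with \<open>m\<close> the square of the
  Mach number, Cauchy-Schwarz bounding \<open>s\<close>. The bound 1/2 puts both speeds below
  \<open>c\<close> and gives \<open>m \<le> 1 / 4\<close>.\<close>

lemma frequency_dilation_estimate:
  assumes "c > 0" "mach c u1 u2 \<le> 1 / 2"
  shows "q00 c u1 u2 > 0"
    and "\<bar>frequency_dilation c u1 u2 - (1 + u1 \<bullet> u2 / c\<^sup>2)\<bar> \<le> 26 * (mach c u1 u2) ^ 4"
proof -
  define M where "M = mach c u1 u2"
  have u: "norm u1 \<le> M * c" "norm u2 \<le> M * c"
    using \<open>c > 0\<close> by (simp_all add: M_def mach_def)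
  have M: "0 \<le> M" "M \<le> 1 / 2"
    using assms by (simp_all add: M_def mach_def le_max_iff_disj)
  have "M * c \<le> 1 / 2 * c" using M \<open>c > 0\<close> by (intro mult_right_mono) auto
  then have lt: "norm u1 < c" "norm u2 < c" using u \<open>c > 0\<close> by linarith+
  have "(norm u1)\<^sup>2 \<le> (M * c)\<^sup>2" using u by (intro power_mono) auto
  then have x: "(norm u1)\<^sup>2 / c\<^sup>2 \<le> M\<^sup>2"
    using \<open>c > 0\<close> by (simp add: divide_le_eq power_mult_distrib)
  have "\<bar>u1 \<bullet> u2\<bar> \<le> norm u1 * norm u2" by (rule Cauchy_Schwarz_ineq2)
  also have "\<dots> \<le> (M * c) * (M * c)" using u M \<open>c > 0\<close> by (intro mult_mono) auto
  finally have s: "\<bar>u1 \<bullet> u2 / c\<^sup>2\<bar> \<le> M\<^sup>2"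
    using \<open>c > 0\<close> by (simp add: abs_divide divide_le_eq power2_eq_square mult_ac)
  have M2: "M\<^sup>2 \<le> 1 / 4" using power_mono[OF M(2,1), of 2] by (simp add: power_divide)
  note est = inverse_sqrt_estimate[OF _ x s M2]
  show "q00 c u1 u2 > 0"
    unfolding q00_scaled[OF \<open>c > 0\<close> lt] by (rule est(1)) simp
  have "\<bar>frequency_dilation c u1 u2 - (1 + u1 \<bullet> u2 / c\<^sup>2)\<bar> \<le> 26 * (M\<^sup>2)\<^sup>2"
    unfolding frequency_dilation_def q00_scaled[OF \<open>c > 0\<close> lt] by (rule est(2)) simp
  then show "\<bar>frequency_dilation c u1 u2 - (1 + u1 \<bullet> u2 / c\<^sup>2)\<bar> \<le> 26 * (mach c u1 u2) ^ 4"
    by (simp add: M_def)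
qed

theorem theorem22:
  fixes c :: real
  assumes "c > 0" and "CARD('n::finite) \<in> {2, 3}"
  shows
    "(\<forall>(u1 :: real ^ 'n) (u2 :: real ^ 'n). norm u1 < c \<longrightarrow> norm u2 < c \<longrightarrow>
        q00 c u1 u2 =
          (lorentz_factor c u1)\<^sup>2 * (lorentz_factor c u2)\<^sup>2 * (1 - (norm (w_vec c u1 u2))\<^sup>2 / c\<^sup>2) \<and>
        q00 c u1 u2 =
          ((c\<^sup>2 - u1 \<bullet> u2)\<^sup>2 - c\<^sup>2 * (norm u1)\<^sup>2) / (c\<^sup>2 * (c\<^sup>2 - (norm u1)\<^sup>2)) \<and>
        (q00 c u1 u2 > 0 \<longrightarrow>
          frequency_dilation c u1 u2 =
            lorentz_factor c (w_vec c u1 u2) / (lorentz_factor c u1 * lorentz_factor c u2))) \<and>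
     (\<forall>(u1 :: real ^ 'n) (u2 :: real ^ 'n) (v1 :: real ^ 'n) (v2 :: real ^ 'n).
        norm u1 < c \<longrightarrow> norm u2 < c \<longrightarrow> norm v1 < c \<longrightarrow> norm v2 < c \<longrightarrow>
        norm u1 = norm v1 \<longrightarrow> u1 \<bullet> u2 = v1 \<bullet> v2 \<longrightarrow>
        q00 c u1 u2 = q00 c v1 v2 \<and>
        (q00 c u1 u2 > 0 \<longrightarrow> frequency_dilation c u1 u2 = frequency_dilation c v1 v2)) \<and>
     (\<forall>\<^sub>F (u1, u2 :: real ^ 'n) in filtercomap (\<lambda>(u1, u2). mach c u1 u2) (nhds 0).
        q00 c u1 u2 > 0) \<and>
     (\<lambda>(u1, u2 :: real ^ 'n). frequency_dilation c u1 u2 - (1 + u1 \<bullet> u2 / c\<^sup>2))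
        \<in> O[filtercomap (\<lambda>(u1, u2). mach c u1 u2) (nhds 0)](\<lambda>(u1, u2). (mach c u1 u2) ^ 4)"
proof -
  \<comment> \<open>Eventually along \<open>?F\<close> means for all pairs with \<open>mach\<close>
    close enough to 0, so the bounds are uniform in both velocities; the pair of zero velocities is
    included.\<close>
  let ?F = "filtercomap (\<lambda>(u1, u2 :: real ^ 'n). mach c u1 u2) (nhds 0)"
  have "\<forall>\<^sub>F M in nhds 0. M < (1 / 2 :: real)" 
    by (rule order_tendstoD(2)[OF filterlim_ident]) simp
  then have small: "\<forall>\<^sub>F p in ?F. mach c (fst p) (snd p) < 1 / 2"
    by (auto simp: eventually_filtercomap case_prod_beta)
  have pos: "\<forall>\<^sub>F (u1, u2) in ?F. q00 c u1 u2 > 0"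
    using small by eventually_elim
      (auto simp: case_prod_beta intro: frequency_dilation_estimate(1)[OF \<open>c > 0\<close>])
  have "(\<lambda>p. frequency_dilation c (fst p) (snd p) - (1 + fst p \<bullet> snd p / c\<^sup>2))
      \<in> O[?F](\<lambda>p. (mach c (fst p) (snd p)) ^ 4)"
  proof (rule bigoI[of _ 26], use small in eventually_elim)
    case (elim p)
    then show ?case
      using frequency_dilation_estimate(2)[OF \<open>c > 0\<close>, of "fst p" "snd p"] by simp
  qed
  then have bigo: "(\<lambda>(u1, u2). frequency_dilation c u1 u2 - (1 + u1 \<bullet> u2 / c\<^sup>2))
      \<in> O[?F](\<lambda>(u1, u2). (mach c u1 u2) ^ 4)"
    by (simp add: case_prod_unfold)
  have invariance: "q00 c u1 u2 = q00 c v1 v2 \<and>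
      (q00 c u1 u2 > 0 \<longrightarrow> frequency_dilation c u1 u2 = frequency_dilation c v1 v2)"
    if "norm u1 < c" "norm u2 < c" "norm v1 < c" "norm v2 < c"
      "norm u1 = norm v1" "u1 \<bullet> u2 = v1 \<bullet> v2" for u1 u2 v1 v2 :: "real ^ 'n"
  proof -
    \<comment> \<open>In the explicit formula \<open>u2\<close> occurs only inside the inner
      product.\<close>
    have "q00 c u1 u2 = q00 c v1 v2"
      using q00_explicit[OF \<open>c > 0\<close> that(1,2)] q00_explicit[OF \<open>c > 0\<close> that(3,4)] that(5,6) by simp
    then show ?thesis by (simp add: frequency_dilation_def)
  qed
  show ?thesis
    using q00_lorentz[OF \<open>c > 0\<close>] q00_explicit[OF \<open>c > 0\<close>]
      frequency_dilation_lorentz[OF \<open>c > 0\<close>] invariance pos bigo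
    by (intro conjI allI impI) blast+
qed

end
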